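(* Assume that the noise $\xi_n=y_nx_n-\mathbb E[y_nx_n]$ has $\mathbb E\|\xi_n\|^2<\infty$ and satisfies $\mathbb E[\xi_n\otimes\xi_n]\preccurlyeq\tau^2\Sigma$ for some $\tau\in\mathbb R$. Let $\gamma>0$ be a constant step-size with $\gamma\Sigma\preccurlyeq I$. Let $\theta_0\in\mathcal H$, $\theta_{-1}=\theta_0$, and for $n\ge1$ $$\theta_n=\big[I-\gamma\Sigma\big](2\theta_{n-1}-\theta_{n-2})+\gamma\,y_nx_n,\qquad \bar\theta_n=\frac1{n+1}\sum_{i=0}^n\theta_i$$ (that is, momentum $\delta=1$ and no regularization, $\lambda=0$). Then for every $n\ge1$ $$\mathbb E f(\bar\theta_n)-f(\theta_* )\le 36\,\frac{\|\theta_0-\theta_*\|^2}{\gamma(n+1)^2}+8\,\frac{\tau^2d}{n+1}.$$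
   Context: $\mathcal H$ is a Euclidean space of dimension $d\ge1$. The observations $(x_n,y_n)\in\mathcal H\times\mathbb R$, $n\ge1$, are i.i.d. with $\mathbb E\|x_n\|^2$ and $\mathbb E y_n^2$ finite. The objective is $f(\theta)=\frac12\mathbb E(\langle x_n,\theta\rangle-y_n)^2$. $\Sigma=\mathbb E[x_n\otimes x_n]$ is the covariance matrix, assumed invertible, and $\theta_*=\Sigma^{-1}\mathbb E[y_nx_n]$ is the global minimizer of $f$. $A\preccurlyeq B$ means that $B-A$ is positive semi-definite. $\theta_0$ is deterministic. *)

theory Defs
  imports "HOL-Probability.Probability"
begin

(* The Bochner integral is restricted to second countable Banach spaces.  This instance makes
   expectations of operator-valued random variables, such as E[x \<otimes> x], available. *)
instance blinfun :: (euclidean_space, euclidean_space) second_countable_topology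
proof
  define mk :: "('b \<times> 'a \<Rightarrow> real) \<Rightarrow> 'a \<Rightarrow>\<^sub>L 'b"
    where "mk g = blinfun_of_matrix (\<lambda>i j. g (i, j))" for g
  define D where "D = mk ` ((Basis \<times> Basis) \<rightarrow>\<^sub>E \<rat>)"
  have countable_D: "countable D"
    unfolding D_def by (intro countable_image countable_PiE finite_cartesian_product)
      (auto intro: countable_rat)
  have dense: "\<exists>d\<in>D. dist f d < e" if "e > 0" for f :: "'a \<Rightarrow>\<^sub>L 'b" and e :: real
  proof -
    define c where "c = e / (2 * (real DIM('b) * real DIM('a)))"
    have "c > 0"
      using that by (simp add: c_def)
    have "\<exists>q\<in>\<rat>. \<bar>f j \<bullet> i - q\<bar> < c" for i j
    proof -
      obtain q where "q \<in> \<rat>" "f j \<bullet> i - c < q" "q < f j \<bullet> i + c"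
        using Rats_dense_in_real[of "f j \<bullet> i - c" "f j \<bullet> i + c"] \<open>c > 0\<close> by auto
      then show ?thesis
        by (intro bexI[of _ q]) auto
    qed
    then have "\<forall>i j. \<exists>q. q \<in> \<rat> \<and> \<bar>f j \<bullet> i - q\<bar> < c"
      by blast
    then obtain q where q: "q i j \<in> \<rat>" "\<bar>f j \<bullet> i - q i j\<bar> < c" for i j
      unfolding choice_iff by blast
    define g where "g = restrict (\<lambda>(i, j). q i j) (Basis \<times> Basis)"
    have "norm (f - mk g) = norm (blinfun_of_matrix (\<lambda>i j. f j \<bullet> i - g (i, j)))"
      using blinfun_of_matrix_minus[of "\<lambda>i j. f j \<bullet> i" "\<lambda>i j. g (i, j)"]
      by (simp add: mk_def blinfun_of_matrix_works fun_diff_def)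
    also have "\<dots> \<le> (\<Sum>i\<in>Basis. \<Sum>j\<in>Basis. \<bar>f j \<bullet> i - g (i, j)\<bar>)"
      by (rule norm_blinfun_of_matrix)
    also have "\<dots> \<le> (\<Sum>i\<in>(Basis :: 'b set). \<Sum>j\<in>(Basis :: 'a set). c)"
      by (intro sum_mono) (auto simp: g_def intro!: less_imp_le[OF q(2)])
    also have "\<dots> = e / 2"
      by (simp add: c_def)
    also have "\<dots> < e"
      using that by simp
    finally have "dist f (mk g) < e"
      by (simp add: dist_norm)
    moreover have "mk g \<in> D"
      unfolding D_def by (rule imageI) (auto simp: g_def q(1) split: if_splits)
    ultimately show ?thesis
      by blast
  qed
  define B where "B = (\<lambda>(d, n). ball d (1 / real (Suc n))) ` (D \<times> (UNIV :: nat set))"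
  have "topological_basis B"
  proof (rule topological_basisI)
    show "open b" if "b \<in> B" for b
      using that by (auto simp: B_def)
  next
    fix U :: "('a \<Rightarrow>\<^sub>L 'b) set" and f
    assume "open U" "f \<in> U"
    then obtain e where e: "e > 0" "ball f e \<subseteq> U"
      using open_contains_ball by blast
    obtain n where n: "1 / real (Suc n) < e / 2"
      using nat_approx_posE[of "e / 2"] e(1) by auto
    obtain d where d: "d \<in> D" "dist f d < 1 / real (Suc n)"
      using dense[of "1 / real (Suc n)" f] by auto
    have "ball d (1 / real (Suc n)) \<subseteq> ball f e"
    proof
      fix h
      assume "h \<in> ball d (1 / real (Suc n))"
      then show "h \<in> ball f e"
        using d(2) n dist_triangle[of f h d] unfolding mem_ball by linarith
    qed
    moreover have "f \<in> ball d (1 / real (Suc n))"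
      using d(2) by (simp add: dist_commute)
    moreover have "ball d (1 / real (Suc n)) \<in> B"
      using d(1) by (auto simp: B_def)
    ultimately show "\<exists>b\<in>B. f \<in> b \<and> b \<subseteq> U"
      using e(2) by blast
  qed
  moreover have "countable B"
    unfolding B_def using countable_D by (intro countable_image countable_SIGMA) auto
  ultimately show "\<exists>B :: ('a \<Rightarrow>\<^sub>L 'b) set set. countable B \<and> open = generate_topology B"
    by (blast intro: topological_basis_imp_subbasis)
qed

lift_definition outer :: "'a::real_inner \<Rightarrow> 'a \<Rightarrow> 'a \<Rightarrow>\<^sub>L 'a" (infixr \<open>\<otimes>\<close> 70)
  is "\<lambda>u v w. (v \<bullet> w) *\<^sub>R u"
  by (intro bounded_linear_intros)

definition pos_semidef :: "('a::real_inner \<Rightarrow>\<^sub>L 'a) \<Rightarrow> bool" where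
  "pos_semidef A \<longleftrightarrow> (\<forall>u v. A u \<bullet> v = u \<bullet> A v) \<and> (\<forall>v. 0 \<le> v \<bullet> A v)"

definition loewner_le :: "('a::real_inner \<Rightarrow>\<^sub>L 'a) \<Rightarrow> ('a \<Rightarrow>\<^sub>L 'a) \<Rightarrow> bool" (infix \<open>\<preceq>\<close> 50) where
  "A \<preceq> B \<longleftrightarrow> pos_semidef (B - A)"

definition iid :: "'w measure \<Rightarrow> (nat \<Rightarrow> 'w \<Rightarrow> 'b::topological_space) \<Rightarrow> nat set \<Rightarrow> bool" where
  "iid M z I \<longleftrightarrow> prob_space.indep_vars M (\<lambda>_. borel) z I \<and>
     (\<forall>i\<in>I. \<forall>j\<in>I. distr M borel (z i) = distr M borel (z j))"

definition objective :: "'w measure \<Rightarrow> ('w \<Rightarrow> 'a::euclidean_space) \<Rightarrow> ('w \<Rightarrow> real) \<Rightarrow> 'a \<Rightarrow> real" where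
  "objective M X Y \<theta> = (1 / 2) * (\<integral>w. (X w \<bullet> \<theta> - Y w)\<^sup>2 \<partial>M)"

(* The uncentred second moment E[X \<otimes> X], which is what "covariance" means for least squares. *)
definition covariance :: "'w measure \<Rightarrow> ('w \<Rightarrow> 'a::euclidean_space) \<Rightarrow> 'a \<Rightarrow>\<^sub>L 'a" where
  "covariance M X = (\<integral>w. X w \<otimes> X w \<partial>M)"

definition optimum :: "'w measure \<Rightarrow> ('w \<Rightarrow> 'a::euclidean_space) \<Rightarrow> ('w \<Rightarrow> real) \<Rightarrow> 'a" where
  "optimum M X Y = inv (blinfun_apply (covariance M X)) (\<integral>w. Y w *\<^sub>R X w \<partial>M)"

definition noise :: "'w measure \<Rightarrow> ('w \<Rightarrow> 'a::euclidean_space) \<Rightarrow> ('w \<Rightarrow> real) \<Rightarrow> 'w \<Rightarrow> 'a" where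
  "noise M X Y w = Y w *\<^sub>R X w - (\<integral>w'. Y w' *\<^sub>R X w' \<partial>M)"

(* In the second equation the subtracted \<theta>0 is the iterate of index -1. *)
fun iterate :: "('a::euclidean_space \<Rightarrow>\<^sub>L 'a) \<Rightarrow> real \<Rightarrow> 'a \<Rightarrow> (nat \<Rightarrow> 'a) \<Rightarrow> nat \<Rightarrow> 'a" where
  "iterate \<Sigma> \<gamma> \<theta>0 v 0 = \<theta>0"
| "iterate \<Sigma> \<gamma> \<theta>0 v (Suc 0) =
     (id_blinfun - \<gamma> *\<^sub>R \<Sigma>) (2 *\<^sub>R \<theta>0 - \<theta>0) + \<gamma> *\<^sub>R v 1"
| "iterate \<Sigma> \<gamma> \<theta>0 v (Suc (Suc n)) =
     (id_blinfun - \<gamma> *\<^sub>R \<Sigma>) (2 *\<^sub>R iterate \<Sigma> \<gamma> \<theta>0 v (Suc n) - iterate \<Sigma> \<gamma> \<theta>0 v n)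
       + \<gamma> *\<^sub>R v (Suc (Suc n))"

definition average :: "(nat \<Rightarrow> 'a::real_vector) \<Rightarrow> nat \<Rightarrow> 'a" where
  "average \<theta> n = (1 / (real n + 1)) *\<^sub>R (\<Sum>i=0..n. \<theta> i)"

end

theory Submission
  imports Defs
begin

text \<open>
  In an orthonormal eigenbasis of \<open>\<Sigma>\<close> the recursion decouples.  Along an eigenvector with eigenvalue
  \<open>s\<close>, put \<open>a = 1 - \<gamma> s\<close>; the coordinate \<open>e\<^sub>n\<close> of \<open>\<theta>\<^sub>n - \<theta>\<^sub>*\<close> satisfies
  \<open>e\<^sub>n = a (2 e\<^sub>n\<^sub>-\<^sub>1 - e\<^sub>n\<^sub>-\<^sub>2) + \<gamma> z\<^sub>n\<close> with uncorrelated centred \<open>z\<^sub>n\<close> of second moment at most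
  \<open>\<tau>\<^sup>2 s\<close>.  Let \<open>A\<^sub>n\<close> be the noiseless solution with \<open>A\<^sub>-\<^sub>1 = A\<^sub>0 = 1\<close>.  The quadratic energy
  \<open>a (A\<^sub>n\<^sub>+\<^sub>1 - A\<^sub>n)\<^sup>2 + (1 - a) A\<^sub>n\<^sub>+\<^sub>1\<^sup>2\<close> is multiplied by \<open>a\<close> at each step, so that \<open>\<bar>A\<^sub>n\<bar> \<le> 1\<close>, and
  since \<open>(1 - a) (A\<^sub>0 + \<dots> + A\<^sub>n) = (1 - a) + a (A\<^sub>n\<^sub>-\<^sub>1 - A\<^sub>n)\<close> the square of this quantity is at most
  \<open>4 (1 - a)\<close>.  Summing the recursion gives
  \<open>(1 - a) (e\<^sub>0 + \<dots> + e\<^sub>n) = (1 - a) (A\<^sub>0 + \<dots> + A\<^sub>n) e\<^sub>0 + \<gamma> \<Sum>\<^sub>k (1 - A\<^sub>n\<^sub>+\<^sub>1\<^sub>-\<^sub>k) z\<^sub>k\<close>, whose second moment is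
  at most \<open>4 \<gamma> s e\<^sub>0\<^sup>2 + 4 n \<gamma>\<^sup>2 \<tau>\<^sup>2 s\<close>.  Adding up the coordinates yields the bound, even with
  both constants replaced by 2.
\<close>

section \<open>Orthonormal eigenbases of self-adjoint operators\<close>

text \<open>The residual is orthogonal to every element of \<open>B\<close>, hence to the whole
  space and in particular to itself.\<close>

lemma orthonormal_expansion:
  fixes B :: "'a::euclidean_space set"
  assumes fin: "finite B" and orth: "pairwise orthogonal B" and nrm: "\<And>b. b \<in> B \<Longrightarrow> norm b = 1"
    and spn: "span B = UNIV"
  shows "v = (\<Sum>b\<in>B. (v \<bullet> b) *\<^sub>R b)"
proof -
  have "(v - (\<Sum>b\<in>B. (v \<bullet> b) *\<^sub>R b)) \<bullet> c = 0" if "c \<in> B" for c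
  proof -
    have "(\<Sum>b\<in>B. (v \<bullet> b) * (b \<bullet> c)) = (\<Sum>b\<in>B. if b = c then v \<bullet> c else 0)"
      using that orth nrm by (intro sum.cong) (auto simp: pairwise_def orthogonal_def dot_square_norm)
    then show ?thesis
      using that fin by (simp add: inner_diff_left inner_sum_left)
  qed
  then have "\<forall>u\<in>span B. orthogonal (v - (\<Sum>b\<in>B. (v \<bullet> b) *\<^sub>R b)) u"
    by (auto simp: orthogonal_def intro: orthogonal_to_span[unfolded orthogonal_def])
  then have "v - (\<Sum>b\<in>B. (v \<bullet> b) *\<^sub>R b) = 0"
    unfolding spn using orthogonal_self by blast
  then show ?thesis by simp
qed

text \<open>The orthogonal complement \<open>W\<close> of \<open>B\<close> is invariant, since
  \<open>f\<close> is self-adjoint and \<open>B\<close> consists of eigenvectors. A maximiser of the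
  quadratic form of \<open>f\<close> on the unit sphere of \<open>W\<close> is then an
  eigenvector.\<close>

lemma selfadjoint_eigenvector_orthogonal:
  fixes f :: "'a::euclidean_space \<Rightarrow> 'a"
  assumes lin: "linear f" and sym: "\<And>u v. f u \<bullet> v = u \<bullet> f v"
    and eig: "\<And>b. b \<in> B \<Longrightarrow> \<exists>c. f b = c *\<^sub>R b" and spn: "span B \<noteq> UNIV"
  obtains u c where "norm u = 1" "f u = c *\<^sub>R u" "\<And>b. b \<in> B \<Longrightarrow> b \<bullet> u = 0"
proof -
  define W where "W = {v. \<forall>b\<in>B. b \<bullet> v = 0}"
  have W_closed: "closed W"
  proof -
    have "W = (\<Inter>b\<in>B. {v. b \<bullet> v = 0})" by (auto simp: W_def)
    then show ?thesis by (simp add: closed_hyperplane closed_INT)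
  qed
  have W_lin: "p + t *\<^sub>R q \<in> W" if "p \<in> W" "q \<in> W" for p q t
    using that by (simp add: W_def inner_add_right)
  have W_f: "f v \<in> W" if v: "v \<in> W" for v
    unfolding W_def
  proof (intro CollectI ballI)
    fix b assume b: "b \<in> B"
    then obtain c where "f b = c *\<^sub>R b" using eig by blast
    then have "f b \<bullet> v = 0" using v b by (simp add: W_def)
    then show "b \<bullet> f v = 0" by (simp add: sym)
  qed
  obtain w0 where w0: "w0 \<noteq> 0" "w0 \<in> W"
  proof -
    obtain w where "w \<noteq> 0" "\<forall>v\<in>span B. w \<bullet> v = 0"
      using span_not_UNIV_orthogonal[OF spn] by auto
    then show thesis using that[of w] by (auto simp: W_def span_base inner_commute)
  qed
  have ne: "sphere 0 1 \<inter> W \<noteq> {}"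
  proof -
    have "0 + (1 / norm w0) *\<^sub>R w0 \<in> W" using w0 by (intro W_lin) (auto simp: W_def)
    moreover have "(1 / norm w0) *\<^sub>R w0 \<in> sphere 0 1" using w0 by simp
    ultimately show ?thesis unfolding add_0 by blast
  qed
  have cont: "continuous_on (sphere 0 1 \<inter> W) (\<lambda>v. v \<bullet> f v)"
    using lin by (intro continuous_intros linear_continuous_on_compose[OF continuous_on_id])
  obtain u where u: "u \<in> sphere 0 1 \<inter> W" and max: "\<And>v. v \<in> sphere 0 1 \<inter> W \<Longrightarrow> v \<bullet> f v \<le> u \<bullet> f u"
    using continuous_attains_sup[OF compact_Int_closed[OF compact_sphere W_closed] ne cont] by blast
  define m where "m = u \<bullet> f u"
  \<comment> \<open>By homogeneity the maximum over the sphere controls the form on all of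
    \<open>W\<close>.\<close>
  have le: "v \<bullet> f v \<le> m * (v \<bullet> v)" if v: "v \<in> W" for v
  proof (cases "v = 0")
    case False
    have "0 + (1 / norm v) *\<^sub>R v \<in> W" using v by (intro W_lin) (auto simp: W_def)
    then have "((1 / norm v) *\<^sub>R v) \<bullet> f ((1 / norm v) *\<^sub>R v) \<le> m"
      unfolding m_def using False by (intro max) auto
    then have "(v \<bullet> f v) / (norm v)\<^sup>2 \<le> m"
      by (simp add: linear_scale[OF lin] power2_eq_square)
    then show ?thesis using False by (simp add: dot_square_norm divide_simps)
  qed (simp add: linear_0[OF lin])
  have uu: "u \<bullet> u = 1" "u \<in> W" using u by (auto simp: dot_square_norm)
  \<comment> \<open>\<open>u\<close> is an eigenvector exactly when this residual vanishes. By
    invariance \<open>w\<close> stays in \<open>W\<close>, so it is an admissible direction in which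
    to perturb \<open>u\<close>.\<close>
  define w where "w = f u - m *\<^sub>R u"
  have wW: "w \<in> W" unfolding w_def using W_lin[OF W_f[OF uu(2)] uu(2), of "- m"] by simp
  have uw: "u \<bullet> w = 0" using uu by (simp add: w_def inner_diff_right m_def)
  have wfu: "w \<bullet> f u = w \<bullet> w"
    using uw by (simp add: w_def inner_diff_right inner_commute)
  define K where "K = m * (w \<bullet> w) - w \<bullet> f w"
  \<comment> \<open>First-order optimality of the maximiser \<open>u\<close> in the direction \<open>w\<close>.\<close>
  have quad: "2 * t * (w \<bullet> w) \<le> t\<^sup>2 * K" for t
  proof -
    have "(u + t *\<^sub>R w) \<bullet> f (u + t *\<^sub>R w) \<le> m * ((u + t *\<^sub>R w) \<bullet> (u + t *\<^sub>R w))"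
      by (intro le W_lin uu wW)
    moreover have "u \<bullet> f w = w \<bullet> w" using sym[of u w] wfu by (simp add: inner_commute)
    ultimately show ?thesis
      using uu uw wfu
      by (simp add: linear_add[OF lin] linear_scale[OF lin] inner_add_left inner_add_right
          inner_commute[of w u] m_def[symmetric] K_def algebra_simps power2_eq_square)
  qed
  have "w \<bullet> w \<le> 0"
  proof (rule ccontr)
    assume "\<not> w \<bullet> w \<le> 0"
    then have pos: "w \<bullet> w > 0" by linarith
    \<comment> \<open>Chosen so that \<open>t * (\<bar>K\<bar> + 1) = w \<bullet> w\<close>: for so
      small a \<open>t\<close> the linear side of \<open>quad\<close> beats the quadratic
      one.\<close>
    define t where "t = (w \<bullet> w) / (\<bar>K\<bar> + 1)"
    have t: "t > 0" using pos by (simp add: t_def)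
    then have "2 * (w \<bullet> w) \<le> t * K" using quad[of t] by (simp add: power2_eq_square)
    also have "\<dots> \<le> t * (\<bar>K\<bar> + 1)" using t by (intro mult_left_mono) auto
    also have "\<dots> = w \<bullet> w" by (simp add: t_def)
    finally show False using pos by simp
  qed
  then have "w = 0" by (metis inner_eq_zero_iff inner_ge_zero order_antisym)
  then show thesis using that[of u m] u uu by (auto simp: w_def W_def)
qed

text \<open>Orthonormal sets are independent, so those made of eigenvectors have bounded cardinality
  and a largest one exists. If it did not span, the preceding lemma would enlarge it.\<close>

lemma selfadjoint_orthonormal_eigenbasis:
  fixes f :: "'a::euclidean_space \<Rightarrow> 'a"
  assumes lin: "linear f" and sym: "\<And>u v. f u \<bullet> v = u \<bullet> f v"
  obtains B where "finite B" "card B = DIM('a)" "pairwise orthogonal B" "span B = UNIV"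
    "\<And>b. b \<in> B \<Longrightarrow> norm b = 1" "\<And>b. b \<in> B \<Longrightarrow> \<exists>c. f b = c *\<^sub>R b"
proof -
  define P where "P B \<longleftrightarrow> pairwise orthogonal B \<and> (\<forall>b\<in>B. norm b = 1 \<and> (\<exists>c. f b = c *\<^sub>R b))" for B
  have ind: "independent B" if "P B" for B
    using that by (intro pairwise_orthogonal_independent) (auto simp: P_def)
  have fin: "finite B" "card B \<le> DIM('a)" if "P B" for B
    using independent_bound[OF ind[OF that]] by auto
  have "P {}" by (simp add: P_def)
  then obtain B where B: "P B" and max: "\<And>C. P C \<Longrightarrow> card C \<le> card B"
    using ex_has_greatest_nat[of P "{}" card "Suc DIM('a)"] fin(2) by (metis le_imp_less_Suc)
  have "span B = UNIV"
  proof (rule ccontr)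
    assume spn: "span B \<noteq> UNIV"
    have "\<exists>c. f b = c *\<^sub>R b" if "b \<in> B" for b using B that by (auto simp: P_def)
    then obtain u c where u: "norm u = 1" "f u = c *\<^sub>R u" "\<And>b. b \<in> B \<Longrightarrow> b \<bullet> u = 0"
      using selfadjoint_eigenvector_orthogonal[OF lin sym _ spn] by blast
    have "P (insert u B)"
      using B u by (auto simp: P_def pairwise_insert orthogonal_def inner_commute)
    moreover have "u \<notin> B" using u by (force simp: norm_eq_1)
    ultimately show False using max[of "insert u B"] fin(1)[OF B] by simp
  qed
  moreover have "card B = DIM('a)"
    using ind[OF B] calculation by (metis dim_UNIV dim_span dim_eq_card)
  ultimately show thesis using that[of B] B fin(1)[OF B] by (auto simp: P_def)
qed

section \<open>The scalar momentum recursion\<close>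

text \<open>The second clause is the third with the value 1 at index -1, since
  \<open>a * (2 * 1 - 1) = a\<close>.\<close>

fun response :: "real \<Rightarrow> nat \<Rightarrow> real" where
  "response a 0 = 1"
| "response a (Suc 0) = a"
| "response a (Suc (Suc n)) = a * (2 * response a (Suc n) - response a n)"

lemma response_energy:
  "a * (response a (Suc n) - response a n)\<^sup>2 + (1 - a) * (response a (Suc n))\<^sup>2 = a ^ Suc n * (1 - a)"
proof (induction n)
  case 0
  show ?case by (simp add: power2_eq_square algebra_simps)
next
  case (Suc n)
  \<comment> \<open>Put r = 2p - q. Apart from the common factor \<open>a\<close>, the terms in a^2
    r^2 cancel, and the rest a r^2 - 2 a r p + p^2 equals a (r - p)^2 + (1 - a) p^2, where r - p = p
    - q.\<close>
  have "a * (a * (2 * p - q) - p)\<^sup>2 + (1 - a) * (a * (2 * p - q))\<^sup>2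
      = a * (a * (p - q)\<^sup>2 + (1 - a) * p\<^sup>2)" for p q :: real
    by (simp add: power2_eq_square algebra_simps)
  then show ?case using Suc by (simp add: mult.assoc)
qed

lemma abs_response_le_1:
  assumes "0 \<le> a" "a < 1"
  shows "\<bar>response a n\<bar> \<le> 1"
proof (cases n)
  case (Suc m)
  have "(1 - a) * (response a n)\<^sup>2 \<le> a ^ n * (1 - a)"
    using response_energy[of a m] assms Suc by (smt (verit) mult_nonneg_nonneg zero_le_power2)
  also have "\<dots> \<le> (1 - a) * 1" using assms by (simp add: power_le_one)
  finally show ?thesis using assms by (simp add: abs_square_le_1)
qed simp

text \<open>The recursion reads (1 - a) A_{n+1} = a (A_n - A_{n-1}) - a (A_{n+1} - A_n), so the sum
  telescopes; the isolated \<open>1 - a\<close> is the summand of index 0.\<close>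

lemma sum_response:
  "(1 - a) * (\<Sum>i=0..Suc n. response a i) = (1 - a) + a * (response a n - response a (Suc n))"
  by (induction n) (simp_all add: algebra_simps)

text \<open>By (x + y)^2 \<le> 2 x^2 + 2 y^2 it suffices that both terms of
  \<open>sum_response\<close> have square at most \<open>1 - a\<close>; for the second one this is
  the energy identity. That closed form starts at index 1, so index 0 is treated separately.\<close>

lemma sum_response_sq_le:
  assumes "0 \<le> a" "a \<le> 1"
  shows "((1 - a) * (\<Sum>i=0..n. response a i))\<^sup>2 \<le> 4 * (1 - a)"
proof (cases n)
  case 0
  have "(1 - a)\<^sup>2 \<le> 1 * (1 - a)" unfolding power2_eq_square using assms by (intro mult_right_mono) auto
  then show ?thesis using assms 0 by simp
next
  case (Suc m)
  define d where "d = response a m - response a (Suc m)"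
  have "a * d\<^sup>2 \<le> a ^ Suc m * (1 - a)"
    using response_energy[of a m] assms unfolding d_def
    by (smt (verit) mult_nonneg_nonneg zero_le_power2 power2_commute)
  also have "\<dots> \<le> 1 * (1 - a)" using assms by (intro mult_right_mono power_le_one) auto
  finally have "a * (a * d\<^sup>2) \<le> 1 * (1 - a)"
    using assms by (smt (verit) mult_left_le_one_le mult_nonneg_nonneg zero_le_power2)
  then have ad: "(a * d)\<^sup>2 \<le> 1 - a" by (simp add: power2_eq_square algebra_simps)
  have "(1 - a)\<^sup>2 \<le> 1 * (1 - a)" unfolding power2_eq_square using assms by (intro mult_right_mono) auto
  moreover have "((1 - a) + a * d)\<^sup>2 \<le> 2 * (1 - a)\<^sup>2 + 2 * (a * d)\<^sup>2"
    using sum_squares_bound[of "1 - a" "a * d"] by (simp add: power2_sum)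
  ultimately have "((1 - a) + a * d)\<^sup>2 \<le> 2 * (1 * (1 - a)) + 2 * (1 - a)"
    using ad by (meson add_mono mult_left_mono order_trans zero_le_numeral)
  then show ?thesis unfolding Suc sum_response d_def[symmetric] by simp
qed

text \<open>Both sides solve the same inhomogeneous second-order recursion in \<open>n\<close> and
  agree at 0 and 1. The weight 1 - A_j is the response from rest to the constant source
  \<open>1 - a\<close>, because the constant 1 solves the recursion with that source.\<close>

lemma sum_momentum_recursion:
  fixes e z :: "nat \<Rightarrow> real"
  assumes e1: "e (Suc 0) = a * e 0 + z (Suc 0)"
    and e2: "\<And>n. e (Suc (Suc n)) = a * (2 * e (Suc n) - e n) + z (Suc (Suc n))"
  shows "(1 - a) * (\<Sum>i=0..n. e i)
    = (1 - a) * (\<Sum>i=0..n. response a i) * e 0 + (\<Sum>k=1..n. (1 - response a (Suc n - k)) * z k)"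
proof -
  define S where "S n = (\<Sum>i=0..n. e i)" for n
  define Q where "Q n = (\<Sum>i=0..n. response a i)" for n
  define Z where "Z n = (\<Sum>k=1..n. z k)" for n
  define R where "R n = (\<Sum>k=1..n. (1 - response a (Suc n - k)) * z k)" for n
  \<comment> \<open>Adding up the recursions with the convention e_{-1} = e_0 leaves the boundary
    term e_0 - a e_{-1}, which is \<open>(1 - a) * e 0\<close>.\<close>
  have S_rec: "S (Suc (Suc n)) = a * (2 * S (Suc n) - S n) + (1 - a) * e 0 + Z (Suc (Suc n))" for n
  proof (induction n)
    case 0
    show ?case by (simp add: S_def Z_def e1 e2 algebra_simps)
  next
    case (Suc n)
    have "S (Suc m) = S m + e (Suc m)" "Z (Suc m) = Z m + z (Suc m)" for m
      by (simp_all add: S_def Z_def)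
    then show ?case using Suc e2[of "Suc n"] by (simp add: algebra_simps)
  qed
  have Q_rec: "Q (Suc (Suc n)) = a * (2 * Q (Suc n) - Q n) + (1 - a)" for n
  proof (induction n)
    case 0
    show ?case by (simp add: Q_def algebra_simps)
  next
    case (Suc n)
    have "Q (Suc m) = Q m + response a (Suc m)" for m by (simp add: Q_def)
    then show ?case using Suc response.simps(3)[of a "Suc n"] by (simp add: algebra_simps)
  qed
  have R_rec: "R (Suc (Suc n)) = a * (2 * R (Suc n) - R n) + (1 - a) * Z (Suc (Suc n))" for n
  proof -
    \<comment> \<open>The added summands vanish: truncated subtraction leaves \<open>response a 0 = 1\<close>.\<close>
    have R_ext: "R n = (\<Sum>k=1..Suc (Suc n). (1 - response a (Suc n - k)) * z k)"
      "R (Suc n) = (\<Sum>k=1..Suc (Suc n). (1 - response a (Suc (Suc n) - k)) * z k)"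
      by (simp_all add: R_def)
    \<comment> \<open>For \<open>k = Suc (Suc n)\<close> both older weights are 0 and the new one is
      \<open>1 - response a 1 = 1 - a\<close>, which is exactly the source term.\<close>
    have "(1 - response a (Suc (Suc (Suc n)) - k)) * z k
      = a * (2 * ((1 - response a (Suc (Suc n) - k)) * z k) - (1 - response a (Suc n - k)) * z k)
        + (1 - a) * z k" if "k \<in> {1..Suc (Suc n)}" for k
    proof (cases "k = Suc (Suc n)")
      case False
      then have "k \<le> Suc n" using that by auto
      then have "Suc (Suc (Suc n)) - k = Suc (Suc (Suc n - k))" "Suc (Suc n) - k = Suc (Suc n - k)"
        by (simp_all add: Suc_diff_le)
      then show ?thesis by (simp add: algebra_simps)
    qed simp
    then have "R (Suc (Suc n)) = (\<Sum>k=1..Suc (Suc n).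
        a * (2 * ((1 - response a (Suc (Suc n) - k)) * z k) - (1 - response a (Suc n - k)) * z k)
        + (1 - a) * z k)"
      unfolding R_def by (rule sum.cong[OF refl])
    then show ?thesis
      unfolding R_ext Z_def
      by (simp only: sum.distrib sum_subtractf sum_distrib_left[symmetric])
  qed
  \<comment> \<open>The recursion has order two, so the induction carries two consecutive
    indices.\<close>
  have "(1 - a) * S n = (1 - a) * Q n * e 0 + R n \<and>
    (1 - a) * S (Suc n) = (1 - a) * Q (Suc n) * e 0 + R (Suc n)"
  proof (induction n)
    case 0
    show ?case by (simp add: S_def Q_def R_def e1 algebra_simps)
  next
    case (Suc n)
    have "(1 - a) * S (Suc (Suc n)) = a * (2 * ((1 - a) * S (Suc n)) - (1 - a) * S n)
        + (1 - a) * ((1 - a) * e 0) + (1 - a) * Z (Suc (Suc n))"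
      by (simp only: S_rec) (simp add: algebra_simps)
    also have "\<dots> = (1 - a) * Q (Suc (Suc n)) * e 0 + R (Suc (Suc n))"
      unfolding R_rec Q_rec Suc[THEN conjunct1] Suc[THEN conjunct2] by (simp add: algebra_simps)
    finally show ?case using Suc by simp
  qed
  then show ?thesis by (simp add: S_def Q_def R_def)
qed

section \<open>Second moments and the least-squares objective\<close>

text \<open>Yields continuity of \<open>p \<otimes> p\<close> in \<open>p\<close>, hence
  measurability of the operator-valued integrand behind \<open>covariance\<close>.\<close>

lemma bounded_bilinear_outer: "bounded_bilinear (outer :: 'a::real_inner \<Rightarrow> 'a \<Rightarrow> 'a \<Rightarrow>\<^sub>L 'a)"
proof
  show "\<exists>K. \<forall>a b. norm ((a :: 'a) \<otimes> b) \<le> norm a * norm b * K"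
  proof (intro exI allI)
    fix a b :: 'a
    show "norm (a \<otimes> b) \<le> norm a * norm b * 1"
    proof (rule norm_blinfun_bound)
      fix w
      have "\<bar>b \<bullet> w\<bar> * norm a \<le> (norm b * norm w) * norm a"
        by (intro mult_right_mono Cauchy_Schwarz_ineq2) simp
      then show "norm ((a \<otimes> b) w) \<le> norm a * norm b * 1 * norm w"
        by (simp add: outer.rep_eq ac_simps)
    qed simp
  qed
qed (auto intro!: blinfun_eqI
      simp: outer.rep_eq blinfun.bilinear_simps inner_add_left scaleR_add_left scaleR_add_right)

lemma integrable_mult_square_integrable:
  fixes f g :: "'a \<Rightarrow> real"
  assumes [measurable]: "f \<in> borel_measurable M" "g \<in> borel_measurable M"
    and "integrable M (\<lambda>w. (f w)\<^sup>2)" "integrable M (\<lambda>w. (g w)\<^sup>2)"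
  shows "integrable M (\<lambda>w. f w * g w)"
proof (rule Bochner_Integration.integrable_bound)
  show "integrable M (\<lambda>w. (f w)\<^sup>2 + (g w)\<^sup>2)" using assms by simp
  have "2 * (\<bar>p\<bar> * \<bar>q\<bar>) \<le> p\<^sup>2 + q\<^sup>2" for p q :: real
    using sum_squares_bound[of "\<bar>p\<bar>" "\<bar>q\<bar>"] by simp
  then have "\<bar>p\<bar> * \<bar>q\<bar> \<le> p\<^sup>2 + q\<^sup>2" for p q :: real
    by (smt (verit) zero_le_power2)
  then show "AE w in M. norm (f w * g w) \<le> norm ((f w)\<^sup>2 + (g w)\<^sup>2)"
    by (simp add: abs_mult)
qed simp

lemma integrable_inner_sq:
  fixes X :: "'w \<Rightarrow> 'a::euclidean_space"
  assumes [measurable]: "X \<in> borel_measurable M" and sq: "integrable M (\<lambda>w. (norm (X w))\<^sup>2)"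
  shows "integrable M (\<lambda>w. (X w \<bullet> u)\<^sup>2)"
proof (rule Bochner_Integration.integrable_bound)
  show "integrable M (\<lambda>w. (norm u)\<^sup>2 * (norm (X w))\<^sup>2)" using sq by simp
  show "AE w in M. norm ((X w \<bullet> u)\<^sup>2) \<le> norm ((norm u)\<^sup>2 * (norm (X w))\<^sup>2)"
    using Cauchy_Schwarz_ineq[of _ u]
    by (intro AE_I2) (simp add: power2_norm_eq_inner mult.commute[of "u \<bullet> u"])
qed simp

lemma integrable_scaleR_square_integrable:
  fixes X :: "'w \<Rightarrow> 'a::euclidean_space"
  assumes [measurable]: "X \<in> borel_measurable M" "Y \<in> borel_measurable M"
    and "integrable M (\<lambda>w. (norm (X w))\<^sup>2)" "integrable M (\<lambda>w. (Y w)\<^sup>2)"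
  shows "integrable M (\<lambda>w. Y w *\<^sub>R X w)"
proof (rule Bochner_Integration.integrable_bound)
  show "integrable M (\<lambda>w. Y w * norm (X w))"
    using assms by (intro integrable_mult_square_integrable) simp_all
qed simp_all

text \<open>Sending \<open>A\<close> to \<open>A u \<bullet> v\<close> is a bounded linear
  functional and so commutes with the Bochner integral, which exists because
  \<open>p \<otimes> p\<close> has norm at most the square of the norm of \<open>p\<close>.\<close>

lemma covariance_inner:
  fixes X :: "'w \<Rightarrow> 'a::euclidean_space"
  assumes [measurable]: "X \<in> borel_measurable M" and sq: "integrable M (\<lambda>w. (norm (X w))\<^sup>2)"
  shows "covariance M X u \<bullet> v = (\<integral>w. (X w \<bullet> u) * (X w \<bullet> v) \<partial>M)"
proof -
  have cont: "continuous_on UNIV (\<lambda>p :: 'a. p \<otimes> p)"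
    by (intro bounded_bilinear.continuous_on[OF bounded_bilinear_outer] continuous_intros)
  have int: "integrable M (\<lambda>w. X w \<otimes> X w)"
  proof (rule Bochner_Integration.integrable_bound[OF sq])
    show "(\<lambda>w. X w \<otimes> X w) \<in> borel_measurable M"
      using measurable_compose[OF assms(1) borel_measurable_continuous_onI[OF cont]] .
    have "norm (p \<otimes> p) \<le> (norm p)\<^sup>2" for p :: 'a
    proof (rule norm_blinfun_bound)
      show "norm ((p \<otimes> p) w) \<le> (norm p)\<^sup>2 * norm w" for w
        using mult_right_mono[OF Cauchy_Schwarz_ineq2[of p w], of "norm p"]
        by (simp add: outer.rep_eq power2_eq_square ac_simps)
    qed simp
    then show "AE w in M. norm (X w \<otimes> X w) \<le> norm ((norm (X w))\<^sup>2)"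
      by simp
  qed
  have "bounded_linear (\<lambda>A :: 'a \<Rightarrow>\<^sub>L 'a. A u \<bullet> v)"
    by (intro bounded_linear_intros)
  from integral_bounded_linear[OF this int] show ?thesis
    by (simp add: covariance_def outer.rep_eq inner_commute mult.commute)
qed

lemma covariance_inner_commute:
  fixes X :: "'w \<Rightarrow> 'a::euclidean_space"
  assumes "X \<in> borel_measurable M" "integrable M (\<lambda>w. (norm (X w))\<^sup>2)"
  shows "covariance M X u \<bullet> v = u \<bullet> covariance M X v"
  unfolding inner_commute[of u "covariance M X v"] covariance_inner[OF assms]
  by (simp only: mult.commute)

text \<open>The normal equation turns the linear term of the objective into
  \<open>covariance M X p \<bullet> r\<close>; symmetry of the covariance then completes the square
  around \<open>p\<close>.\<close>

lemma objective_diff: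
  fixes X :: "'w \<Rightarrow> 'a::euclidean_space"
  assumes [measurable]: "X \<in> borel_measurable M" "Y \<in> borel_measurable M"
    and sqX: "integrable M (\<lambda>w. (norm (X w))\<^sup>2)" and sqY: "integrable M (\<lambda>w. (Y w)\<^sup>2)"
    and normal_eq: "covariance M X p = (\<integral>w. Y w *\<^sub>R X w \<partial>M)"
  shows "objective M X Y q - objective M X Y p = 1 / 2 * ((q - p) \<bullet> covariance M X (q - p))"
proof -
  have int: "integrable M (\<lambda>w. Y w *\<^sub>R X w)"
    by (rule integrable_scaleR_square_integrable) (simp_all add: sqX sqY)
  have expand: "2 * objective M X Y r
      = covariance M X r \<bullet> r - 2 * (covariance M X p \<bullet> r) + (\<integral>w. (Y w)\<^sup>2 \<partial>M)" for r
  proof -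
    have "2 * objective M X Y r
      = (\<integral>w. (X w \<bullet> r)\<^sup>2 - 2 * ((Y w *\<^sub>R X w) \<bullet> r) + (Y w)\<^sup>2 \<partial>M)"
      by (simp add: objective_def power2_diff algebra_simps)
    also have "\<dots> = (\<integral>w. (X w \<bullet> r)\<^sup>2 \<partial>M) - 2 * (\<integral>w. (Y w *\<^sub>R X w) \<bullet> r \<partial>M) + (\<integral>w. (Y w)\<^sup>2 \<partial>M)"
      using integrable_inner_sq[OF assms(1) sqX, of r] integrable_inner_left[OF int, of r] sqY
      by (simp del: inner_scaleR_left)
    also have "(\<integral>w. (Y w *\<^sub>R X w) \<bullet> r \<partial>M) = covariance M X p \<bullet> r"
      unfolding normal_eq by (rule integral_inner_left) (rule int)
    finally show ?thesis
      by (simp add: covariance_inner[OF assms(1) sqX] power2_eq_square)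
  qed
  show ?thesis
    using expand[of q] expand[of p] covariance_inner_commute[OF assms(1) sqX, of p q]
    by (simp add: inner_diff_left inner_diff_right blinfun.diff_right inner_commute)
qed

text \<open>Mixed expectations factor by independence; zero means then kill them together with the
  term linear in \<open>\<alpha>\<close>, and only the diagonal survives.\<close>

lemma (in prob_space) second_moment_indep_sum:
  fixes Z :: "'i \<Rightarrow> 'a \<Rightarrow> real"
  assumes fin: "finite I" and ind: "indep_vars (\<lambda>_. borel) Z I"
    and sq: "\<And>k. k \<in> I \<Longrightarrow> integrable M (\<lambda>w. (Z k w)\<^sup>2)"
    and mean: "\<And>k. k \<in> I \<Longrightarrow> expectation (Z k) = 0"
  shows "integrable M (\<lambda>w. (\<alpha> + (\<Sum>k\<in>I. c k * Z k w))\<^sup>2)" (is ?int)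
    and "expectation (\<lambda>w. (\<alpha> + (\<Sum>k\<in>I. c k * Z k w))\<^sup>2)
      = \<alpha>\<^sup>2 + (\<Sum>k\<in>I. (c k)\<^sup>2 * expectation (\<lambda>w. (Z k w)\<^sup>2))" (is ?eq)
proof -
  have rv[measurable]: "k \<in> I \<Longrightarrow> random_variable borel (Z k)" for k
    using ind by (simp add: indep_vars_def2)
  have int: "integrable M (Z k)" if "k \<in> I" for k
    using square_integrable_imp_integrable[OF rv sq] that by blast
  have prod_int: "integrable M (\<lambda>w. Z i w * Z j w)" if "i \<in> I" "j \<in> I" for i j
    using that by (intro integrable_mult_square_integrable rv sq)
  have uncorr: "expectation (\<lambda>w. Z i w * Z j w) = (if i = j then expectation (\<lambda>w. (Z i w)\<^sup>2) else 0)"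
    if "i \<in> I" "j \<in> I" for i j
  proof (cases "i = j")
    case False
    have "indep_vars (\<lambda>_. borel) Z {i, j}"
      using that by (intro indep_vars_subset[OF ind]) simp
    then have "expectation (\<lambda>w. \<Prod>k\<in>{i, j}. Z k w) = (\<Prod>k\<in>{i, j}. expectation (Z k))"
      using that int by (intro indep_vars_lebesgue_integral) auto
    then show ?thesis using False mean that by simp
  qed (simp add: power2_eq_square)
  have expand: "(\<alpha> + (\<Sum>k\<in>I. c k * Z k w))\<^sup>2 = \<alpha>\<^sup>2 + 2 * \<alpha> * (\<Sum>k\<in>I. c k * Z k w)
      + (\<Sum>i\<in>I. \<Sum>j\<in>I. c i * c j * (Z i w * Z j w))" for w
  proof -
    have "(\<Sum>k\<in>I. c k * Z k w) * (\<Sum>k\<in>I. c k * Z k w) = (\<Sum>i\<in>I. \<Sum>j\<in>I. c i * c j * (Z i w * Z j w))"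
      unfolding sum_product by (intro sum.cong refl) algebra
    then show ?thesis by (simp only: power2_sum power2_eq_square[of "sum _ _"])
  qed
  have ints: "integrable M (\<lambda>w. \<Sum>k\<in>I. c k * Z k w)"
    "integrable M (\<lambda>w. \<Sum>i\<in>I. \<Sum>j\<in>I. c i * c j * (Z i w * Z j w))"
    using int prod_int by (auto intro!: Bochner_Integration.integrable_sum)
  show ?int unfolding expand using ints by simp
  have "expectation (\<lambda>w. \<Sum>k\<in>I. c k * Z k w) = 0"
    using int mean by (subst Bochner_Integration.integral_sum) auto
  moreover have "expectation (\<lambda>w. \<Sum>i\<in>I. \<Sum>j\<in>I. c i * c j * (Z i w * Z j w))
      = (\<Sum>i\<in>I. \<Sum>j\<in>I. c i * c j * expectation (\<lambda>w. Z i w * Z j w))"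
    using prod_int by (simp add: Bochner_Integration.integral_sum)
  moreover have "\<dots> = (\<Sum>i\<in>I. (c i)\<^sup>2 * expectation (\<lambda>w. (Z i w)\<^sup>2))"
  proof (rule sum.cong[OF refl])
    fix i assume i: "i \<in> I"
    have "(\<Sum>j\<in>I. c i * c j * expectation (\<lambda>w. Z i w * Z j w))
        = (\<Sum>j\<in>I. if i = j then (c i)\<^sup>2 * expectation (\<lambda>w. (Z i w)\<^sup>2) else 0)"
      using i by (intro sum.cong refl) (auto simp: uncorr power2_eq_square[of "c _"])
    then show "(\<Sum>j\<in>I. c i * c j * expectation (\<lambda>w. Z i w * Z j w))
        = (c i)\<^sup>2 * expectation (\<lambda>w. (Z i w)\<^sup>2)"
      using i fin by simp
  qed
  moreover have "expectation (\<lambda>w. (\<alpha> + (\<Sum>k\<in>I. c k * Z k w))\<^sup>2)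
      = \<alpha>\<^sup>2 + 2 * \<alpha> * expectation (\<lambda>w. \<Sum>k\<in>I. c k * Z k w)
        + expectation (\<lambda>w. \<Sum>i\<in>I. \<Sum>j\<in>I. c i * c j * (Z i w * Z j w))"
    unfolding expand using ints
    by (subst Bochner_Integration.integral_add) (simp_all add: prob_space del: Bochner_Integration.integral_sum)
  ultimately show ?eq by (simp only: mult_zero_right add_0_right)
qed

text \<open>Split into the deterministic bias \<open>\<alpha>\<close> and weighted noise. The factor
  \<open>(1 - a)\<^sup>2\<close> is left undivided: in the application \<open>V\<close> is itself a
  multiple of \<open>1 - a\<close>, and one such factor cancels throughout.\<close>

lemma (in prob_space) second_moment_sum_momentum:
  fixes Z :: "nat \<Rightarrow> 'a \<Rightarrow> real" and e :: "'a \<Rightarrow> nat \<Rightarrow> real"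
  assumes ind: "indep_vars (\<lambda>_. borel) Z {1..n}"
    and sq: "\<And>k. k \<in> {1..n} \<Longrightarrow> integrable M (\<lambda>w. (Z k w)\<^sup>2)"
    and mean: "\<And>k. k \<in> {1..n} \<Longrightarrow> expectation (Z k) = 0"
    and var: "\<And>k. k \<in> {1..n} \<Longrightarrow> expectation (\<lambda>w. (Z k w)\<^sup>2) \<le> V"
    and a: "0 \<le> a" "a < 1"
    and e0: "\<And>w. e w 0 = c"
    and e1: "\<And>w. e w (Suc 0) = a * e w 0 + Z (Suc 0) w"
    and e2: "\<And>w m. e w (Suc (Suc m)) = a * (2 * e w (Suc m) - e w m) + Z (Suc (Suc m)) w"
  shows "integrable M (\<lambda>w. (\<Sum>i=0..n. e w i)\<^sup>2)"
    and "(1 - a)\<^sup>2 * expectation (\<lambda>w. (\<Sum>i=0..n. e w i)\<^sup>2) \<le> 4 * (1 - a) * c\<^sup>2 + 4 * real n * V"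
proof -
  define \<alpha> where "\<alpha> = (1 - a) * (\<Sum>i=0..n. response a i) * c"
  define g where "g k = 1 - response a (Suc n - k)" for k
  have eq: "(1 - a) * (\<Sum>i=0..n. e w i) = \<alpha> + (\<Sum>k=1..n. g k * Z k w)" for w
    using sum_momentum_recursion[of "e w" a "\<lambda>k. Z k w" n, OF e1 e2] by (simp add: \<alpha>_def g_def e0)
  note moment = second_moment_indep_sum[OF finite_atLeastAtMost ind sq mean, of \<alpha> g]
  have eq2: "(1 - a)\<^sup>2 * (\<Sum>i=0..n. e w i)\<^sup>2 = (\<alpha> + (\<Sum>k=1..n. g k * Z k w))\<^sup>2" for w
    unfolding eq[symmetric] by (simp add: power_mult_distrib)
  have "integrable M (\<lambda>w. (1 - a)\<^sup>2 * (\<Sum>i=0..n. e w i)\<^sup>2)"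
    unfolding eq2 using moment(1) by simp
  then show "integrable M (\<lambda>w. (\<Sum>i=0..n. e w i)\<^sup>2)"
    using a by simp
  have "(1 - a)\<^sup>2 * expectation (\<lambda>w. (\<Sum>i=0..n. e w i)\<^sup>2)
      = expectation (\<lambda>w. (\<alpha> + (\<Sum>k=1..n. g k * Z k w))\<^sup>2)"
    unfolding eq2[symmetric] by simp
  also have "\<dots> = \<alpha>\<^sup>2 + (\<Sum>k=1..n. (g k)\<^sup>2 * expectation (\<lambda>w. (Z k w)\<^sup>2))"
    using moment(2) by simp
  also have "\<dots> \<le> 4 * (1 - a) * c\<^sup>2 + (\<Sum>k=1..n. 4 * V)"
  proof (intro add_mono sum_mono)
    show "\<alpha>\<^sup>2 \<le> 4 * (1 - a) * c\<^sup>2"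
      unfolding \<alpha>_def power_mult_distrib[of _ c]
      using a by (intro mult_right_mono sum_response_sq_le) auto
    fix k assume k: "k \<in> {1..n}"
    \<comment> \<open>The weight is 1 minus a response in [-1, 1]; its squared bound is the 4 of the
      noise term.\<close>
    have "\<bar>g k\<bar> \<le> 2"
      using abs_response_le_1[OF a, of "Suc n - k"] unfolding g_def by linarith
    then have "(g k)\<^sup>2 \<le> 4"
      using power_mono[of "\<bar>g k\<bar>" 2 2] by simp
    then show "(g k)\<^sup>2 * expectation (\<lambda>w. (Z k w)\<^sup>2) \<le> 4 * V"
      using var[OF k] by (intro mult_mono) simp_all
  qed
  finally show "(1 - a)\<^sup>2 * expectation (\<lambda>w. (\<Sum>i=0..n. e w i)\<^sup>2) \<le> 4 * (1 - a) * c\<^sup>2 + 4 * real n * V"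
    by simp
qed

section \<open>The averaged iterates\<close>

text \<open>Every \<open>p\<close> is a fixed point of the recursion with constant input
  \<open>\<Sigma> p\<close>, so subtracting \<open>p\<close> merely recentres the input. Symmetry
  moves \<open>\<Sigma>\<close> onto \<open>b\<close>, where it acts as the scalar
  \<open>s\<close>.\<close>

lemma iterate_inner_eigenvector:
  fixes \<Sigma> :: "'a::euclidean_space \<Rightarrow>\<^sub>L 'a" and \<gamma> :: real and r p :: 'a and v :: "nat \<Rightarrow> 'a"
  assumes sym: "\<And>u v. \<Sigma> u \<bullet> v = u \<bullet> \<Sigma> v" and eig: "\<Sigma> b = s *\<^sub>R b"
  defines "e \<equiv> \<lambda>n. (iterate \<Sigma> \<gamma> r v n - p) \<bullet> b"
    and "z \<equiv> \<lambda>n. \<gamma> * ((v n - \<Sigma> p) \<bullet> b)"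
  shows "e (Suc 0) = (1 - \<gamma> * s) * e 0 + z (Suc 0)"
    and "e (Suc (Suc n)) = (1 - \<gamma> * s) * (2 * e (Suc n) - e n) + z (Suc (Suc n))"
proof -
  have S: "\<Sigma> u \<bullet> b = s * (u \<bullet> b)" for u
    by (simp add: sym eig)
  have lin: "((id_blinfun - \<gamma> *\<^sub>R \<Sigma>) q + \<gamma> *\<^sub>R u - p) \<bullet> b
      = (1 - \<gamma> * s) * ((q - p) \<bullet> b) + \<gamma> * ((u - \<Sigma> p) \<bullet> b)" for q u
    by (simp add: blinfun.diff_left blinfun.scaleR_left inner_add_left inner_diff_left S)
      (simp add: algebra_simps)
  have "2 *\<^sub>R r - r = r"
    by (simp add: scaleR_2)
  then show "e (Suc 0) = (1 - \<gamma> * s) * e 0 + z (Suc 0)"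
    unfolding e_def z_def by (simp only: iterate.simps lin One_nat_def)
  have "(2 *\<^sub>R q - u - p) \<bullet> b = 2 * ((q - p) \<bullet> b) - (u - p) \<bullet> b" for q u
    by (simp add: inner_diff_left)
  then show "e (Suc (Suc n)) = (1 - \<gamma> * s) * (2 * e (Suc n) - e n) + z (Suc (Suc n))"
    unfolding e_def z_def by (simp only: iterate.simps lin)
qed

lemma average_diff: "average \<theta> n - p = (1 / (real n + 1)) *\<^sub>R (\<Sum>i=0..n. \<theta> i - p)"
proof -
  have "(\<Sum>i=0..n. \<theta> i - p) = (\<Sum>i=0..n. \<theta> i) - (real n + 1) *\<^sub>R p"
    by (simp add: sum_subtractf sum_constant_scaleR del: sum_constant)
  then show ?thesis
    by (simp add: average_def scaleR_diff_right)
qed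

theorem corollary1:
  fixes M :: "'w measure"
    and x :: "nat \<Rightarrow> 'w \<Rightarrow> 'a::euclidean_space"
    and y :: "nat \<Rightarrow> 'w \<Rightarrow> real"
    and \<Sigma> :: "'a \<Rightarrow>\<^sub>L 'a"
    and f :: "'a \<Rightarrow> real"
    and \<theta>0 \<theta>_star :: 'a
    and \<theta> :: "'w \<Rightarrow> nat \<Rightarrow> 'a"
    and \<gamma> \<tau> :: real
    and n :: nat
  assumes "prob_space M"
    and "iid M (\<lambda>n w. (x n w, y n w)) {1..}"
    and "\<And>n. n \<ge> 1 \<Longrightarrow> integrable M (\<lambda>w. (norm (x n w))\<^sup>2)"
    and "\<And>n. n \<ge> 1 \<Longrightarrow> integrable M (\<lambda>w. (y n w)\<^sup>2)"
    and "f = objective M (x 1) (y 1)"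
    and "\<Sigma> = covariance M (x 1)"
    and "bij (blinfun_apply \<Sigma>)"
    and "\<theta>_star = optimum M (x 1) (y 1)"
    and "\<And>n. n \<ge> 1 \<Longrightarrow> integrable M (\<lambda>w. (norm (noise M (x n) (y n) w))\<^sup>2)"
    and "\<And>n. n \<ge> 1 \<Longrightarrow>
           (\<integral>w. noise M (x n) (y n) w \<otimes> noise M (x n) (y n) w \<partial>M) \<preceq> \<tau>\<^sup>2 *\<^sub>R \<Sigma>"
    and "\<gamma> > 0"
    and "\<gamma> *\<^sub>R \<Sigma> \<preceq> id_blinfun"
    and "\<theta> = (\<lambda>w. iterate \<Sigma> \<gamma> \<theta>0 (\<lambda>n. y n w *\<^sub>R x n w))"
    and "n \<ge> 1"
  shows "(\<integral>w. f (average (\<theta> w) n) \<partial>M) - f \<theta>_star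
           \<le> 36 * ((norm (\<theta>0 - \<theta>_star))\<^sup>2 / (\<gamma> * (real n + 1)\<^sup>2))
              + 8 * (\<tau>\<^sup>2 * real DIM('a) / (real n + 1))"
proof -
  interpret prob_space M by (rule assms(1))
  let ?N = "real n + 1"
  define \<eta> where "\<eta> = \<theta>0 - \<theta>_star"

  \<comment> \<open>Measurability, the normal equation and centring of the noise\<close>
  have ind: "indep_vars (\<lambda>_. borel) (\<lambda>k w. (x k w, y k w)) {1..}"
    and ident: "\<And>i j. 1 \<le> i \<Longrightarrow> 1 \<le> j \<Longrightarrow>
      distr M borel (\<lambda>w. (x i w, y i w)) = distr M borel (\<lambda>w. (x j w, y j w))"
    using assms(2) unfolding iid_def Ball_def atLeast_iff by blast+
  have pair: "(\<lambda>w. (x k w, y k w)) \<in> borel_measurable M" if "1 \<le> k" for k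
    using ind that by (simp add: indep_vars_def2)
  have x: "x k \<in> borel_measurable M" if "1 \<le> k" for k
    using measurable_compose[OF pair[OF that] borel_measurable_continuous_onI[OF continuous_on_fst[OF continuous_on_id]]]
    by simp
  have y: "y k \<in> borel_measurable M" if "1 \<le> k" for k
    using measurable_compose[OF pair[OF that] borel_measurable_continuous_onI[OF continuous_on_snd[OF continuous_on_id]]]
    by simp
  have yx_int: "integrable M (\<lambda>w. y k w *\<^sub>R x k w)" if "1 \<le> k" for k
    using that by (intro integrable_scaleR_square_integrable x y assms(3,4))
  \<comment> \<open>Surjectivity of \<open>\<Sigma>\<close> makes \<open>inv\<close> a right
    inverse, so \<open>\<theta>_star\<close> solves the normal equation.\<close>
  have \<Sigma>_opt: "\<Sigma> \<theta>_star = expectation (\<lambda>w. y 1 w *\<^sub>R x 1 w)"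
    using assms(6-8) by (simp add: optimum_def bij_is_surj surj_f_inv_f)
  \<comment> \<open>The mean depends only on the joint law of the pair, and that law is the same for
    index \<open>k\<close> as for index 1.\<close>
  have yx_mean: "expectation (\<lambda>w. y k w *\<^sub>R x k w) = \<Sigma> \<theta>_star" if "1 \<le> k" for k
  proof -
    have meas: "(\<lambda>p :: 'a \<times> real. snd p *\<^sub>R fst p) \<in> borel_measurable borel"
      by (intro borel_measurable_continuous_onI continuous_intros)
    have "expectation (\<lambda>w. y i w *\<^sub>R x i w)
        = integral\<^sup>L (distr M borel (\<lambda>w. (x i w, y i w))) (\<lambda>p. snd p *\<^sub>R fst p)" if "1 \<le> i" for i
      by (subst integral_distr[OF pair[OF that] meas]) simp
    then show ?thesis using ident[OF that, of 1] that by (simp add: \<Sigma>_opt)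
  qed
  have noise: "noise M (x k) (y k) w = y k w *\<^sub>R x k w - \<Sigma> \<theta>_star" if "1 \<le> k" for k w
    using yx_mean[OF that] by (simp add: noise_def)
  have sym: "\<Sigma> u \<bullet> v = u \<bullet> \<Sigma> v" for u v
    unfolding assms(6) by (rule covariance_inner_commute) (simp_all add: x assms(3))

  \<comment> \<open>Spectral decomposition of \<open>\<Sigma>\<close>\<close>
  obtain B where B: "finite B" "card B = DIM('a)" "pairwise orthogonal B" "span B = UNIV"
    "\<And>b. b \<in> B \<Longrightarrow> norm b = 1" "\<And>b. b \<in> B \<Longrightarrow> \<exists>c. \<Sigma> b = c *\<^sub>R b"
    using selfadjoint_orthonormal_eigenbasis[OF bounded_linear.linear[OF blinfun.bounded_linear_right[of \<Sigma>]] sym] by metis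
  obtain s where s: "\<And>b. b \<in> B \<Longrightarrow> \<Sigma> b = s b *\<^sub>R b"
    using B(6) by metis
  note expansion = orthonormal_expansion[OF B(1,3,5,4)]
  have bb: "b \<bullet> b = 1" if "b \<in> B" for b
    using B(5)[OF that] by (simp add: norm_eq_1)
  \<comment> \<open>Nonnegativity comes from the quadratic form being the mean of a square,
    strictness from injectivity of \<open>\<Sigma>\<close>. Strictness is what permits cancelling
    \<open>\<gamma> * s b\<close> later.\<close>
  have s_pos: "0 < s b" if b: "b \<in> B" for b
  proof -
    have "0 \<le> \<Sigma> b \<bullet> b"
      unfolding assms(6) by (subst covariance_inner) (simp_all add: x assms(3))
    then have "0 \<le> s b" using s[OF b] bb[OF b] by simp
    moreover have "s b \<noteq> 0"
    proof
      assume "s b = 0"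
      then have "\<Sigma> b = \<Sigma> 0" using s[OF b] by simp
      then have "b = 0" using assms(7) by (metis bij_is_inj injD)
      then show False using bb[OF b] by simp
    qed
    ultimately show ?thesis by simp
  qed
  have \<gamma>s: "\<gamma> * s b \<le> 1" if b: "b \<in> B" for b
  proof -
    have "0 \<le> b \<bullet> (id_blinfun - \<gamma> *\<^sub>R \<Sigma>) b"
      using assms(12) unfolding loewner_le_def pos_semidef_def by blast
    then show ?thesis using s[OF b] bb[OF b]
      by (simp add: blinfun.bilinear_simps inner_diff_right)
  qed
  \<comment> \<open>The quadratic form is diagonal in the eigenbasis, so the excess risk can be
    bounded one coordinate at a time.\<close>
  have excess: "f q - f \<theta>_star = (\<Sum>b\<in>B. s b / 2 * ((q - \<theta>_star) \<bullet> b)\<^sup>2)" for q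
  proof -
    have "f q - f \<theta>_star = 1 / 2 * ((q - \<theta>_star) \<bullet> \<Sigma> (q - \<theta>_star))"
      unfolding assms(5,6) using \<Sigma>_opt
      by (intro objective_diff x y assms(3,4)) (simp_all add: assms(6))
    also have "(q - \<theta>_star) \<bullet> \<Sigma> (q - \<theta>_star)
        = (\<Sum>b\<in>B. ((q - \<theta>_star) \<bullet> b) *\<^sub>R b) \<bullet> \<Sigma> (q - \<theta>_star)"
      using expansion[of "q - \<theta>_star"] by simp
    also have "\<dots> = (\<Sum>b\<in>B. s b * ((q - \<theta>_star) \<bullet> b)\<^sup>2)"
      unfolding inner_sum_left
      by (intro sum.cong refl)
        (simp add: sym[symmetric] s power2_eq_square inner_commute)
    finally show ?thesis by (simp add: sum_distrib_left)
  qed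

  \<comment> \<open>Bias and variance along one eigenvector\<close>
  have coord: "integrable M (\<lambda>w. ((average (\<theta> w) n - \<theta>_star) \<bullet> b)\<^sup>2)"
    "s b / 2 * expectation (\<lambda>w. ((average (\<theta> w) n - \<theta>_star) \<bullet> b)\<^sup>2)
      \<le> 2 * (\<eta> \<bullet> b)\<^sup>2 / (\<gamma> * ?N\<^sup>2) + 2 * real n * \<tau>\<^sup>2 / ?N\<^sup>2" if b: "b \<in> B" for b
  proof -
    \<comment> \<open>Centring at \<open>\<Sigma> \<theta>_star\<close> matches the input of the
      coordinate recursion for all indices; it agrees with \<open>noise\<close> only from index 1
      on.\<close>
    define Z where "Z k w = \<gamma> * ((y k w *\<^sub>R x k w - \<Sigma> \<theta>_star) \<bullet> b)" for k w
    define e where "e w i = (\<theta> w i - \<theta>_star) \<bullet> b" for w i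
    have Z_noise: "Z k w = \<gamma> * (noise M (x k) (y k) w \<bullet> b)" if "1 \<le> k" for k w
      using noise[OF that] by (simp add: Z_def)
    have noise_meas: "noise M (x k) (y k) \<in> borel_measurable M" if "1 \<le> k" for k
      unfolding noise_def using x[OF that] y[OF that] by measurable
    have Z_ind: "indep_vars (\<lambda>_. borel) Z {1..n}"
    proof -
      have "(\<lambda>p :: 'a \<times> real. \<gamma> * ((snd p *\<^sub>R fst p - \<Sigma> \<theta>_star) \<bullet> b)) \<in> borel_measurable borel"
        by (intro borel_measurable_continuous_onI continuous_intros)
      from indep_vars_compose2[OF indep_vars_subset[OF ind, of "{1..n}"], of "\<lambda>_ p. \<gamma> * ((snd p *\<^sub>R fst p - \<Sigma> \<theta>_star) \<bullet> b)" "\<lambda>_. borel", OF _ this]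
      show ?thesis by (simp add: Z_def[abs_def] subset_iff)
    qed
    have Z_sq: "integrable M (\<lambda>w. (Z k w)\<^sup>2)" if "k \<in> {1..n}" for k
      using that integrable_inner_sq[OF noise_meas[of k] assms(9)[of k], of b]
      by (simp add: Z_noise power_mult_distrib)
    have Z_mean: "expectation (Z k) = 0" if k: "k \<in> {1..n}" for k
      using k yx_int[of k] yx_mean[of k]
      by (simp add: Z_def[abs_def] inner_diff_left prob_space flip: inner_scaleR_left)
    \<comment> \<open>The Loewner bound is tested at the unit eigenvector \<open>b\<close>, where
      the form of \<open>\<Sigma>\<close> is \<open>s b\<close>; the step-size contributes its
      square.\<close>
    have Z_var: "expectation (\<lambda>w. (Z k w)\<^sup>2) \<le> \<gamma>\<^sup>2 * (\<tau>\<^sup>2 * s b)" if k: "k \<in> {1..n}" for k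
    proof -
      have k1: "1 \<le> k" using k by simp
      have "0 \<le> b \<bullet> (\<tau>\<^sup>2 *\<^sub>R \<Sigma> - covariance M (noise M (x k) (y k))) b"
        using assms(10)[OF k1] unfolding loewner_le_def pos_semidef_def covariance_def by blast
      then have "covariance M (noise M (x k) (y k)) b \<bullet> b \<le> \<tau>\<^sup>2 * s b"
        using s[OF b] bb[OF b] by (simp add: blinfun.bilinear_simps inner_diff_right inner_commute)
      then have "expectation (\<lambda>w. (noise M (x k) (y k) w \<bullet> b)\<^sup>2) \<le> \<tau>\<^sup>2 * s b"
        by (simp add: covariance_inner[OF noise_meas[OF k1] assms(9)[OF k1]] power2_eq_square)
      then show ?thesis
        by (simp add: Z_noise[OF k1] power_mult_distrib mult_left_mono)
    qed
    define a where "a = 1 - \<gamma> * s b"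
    have a: "0 \<le> a" "a < 1" using \<gamma>s[OF b] s_pos[OF b] assms(11) by (simp_all add: a_def)
    note rec = iterate_inner_eigenvector[where \<gamma> = \<gamma> and r = \<theta>0 and p = \<theta>_star, OF sym s[OF b], folded a_def]
    have e: "e w 0 = \<eta> \<bullet> b" "e w (Suc 0) = a * e w 0 + Z (Suc 0) w"
      "e w (Suc (Suc m)) = a * (2 * e w (Suc m) - e w m) + Z (Suc (Suc m)) w" for w m
      using rec[of "\<lambda>k. y k w *\<^sub>R x k w"] by (simp_all add: e_def Z_def assms(13) \<eta>_def)
    have moment: "integrable M (\<lambda>w. (\<Sum>i=0..n. e w i)\<^sup>2)"
      "(1 - a)\<^sup>2 * expectation (\<lambda>w. (\<Sum>i=0..n. e w i)\<^sup>2)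
        \<le> 4 * (1 - a) * (\<eta> \<bullet> b)\<^sup>2 + 4 * real n * (\<gamma>\<^sup>2 * (\<tau>\<^sup>2 * s b))"
      by (rule second_moment_sum_momentum[OF Z_ind _ _ _ a e]; (rule Z_sq Z_mean Z_var)?; assumption)+
    have avg: "((average (\<theta> w) n - \<theta>_star) \<bullet> b)\<^sup>2 = (\<Sum>i=0..n. e w i)\<^sup>2 / ?N\<^sup>2" for w
      unfolding average_diff by (simp add: e_def inner_sum_left power_divide)
    show "integrable M (\<lambda>w. ((average (\<theta> w) n - \<theta>_star) \<bullet> b)\<^sup>2)"
      unfolding avg using moment(1) by simp
    let ?E = "expectation (\<lambda>w. (\<Sum>i=0..n. e w i)\<^sup>2)"
    have "(\<gamma> * s b)\<^sup>2 * ?E \<le> 4 * (\<gamma> * s b) * (\<eta> \<bullet> b)\<^sup>2 + 4 * real n * (\<gamma>\<^sup>2 * (\<tau>\<^sup>2 * s b))"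
      using moment(2) by (simp add: a_def)
    \<comment> \<open>Bias and noise bounds share the factor \<open>\<gamma> * s b\<close>.
      Cancelling it once leaves a bound on \<open>s b * ?E\<close> free of the eigenvalue, hence of
      the conditioning of \<open>\<Sigma>\<close>.\<close>
    then have "(\<gamma> * s b) * (\<gamma> * (s b * ?E)) \<le> (\<gamma> * s b) * (4 * (\<eta> \<bullet> b)\<^sup>2 + 4 * real n * \<gamma> * \<tau>\<^sup>2)"
      by (simp add: power2_eq_square algebra_simps)
    then have "\<gamma> * (s b * ?E) \<le> 4 * (\<eta> \<bullet> b)\<^sup>2 + 4 * real n * \<gamma> * \<tau>\<^sup>2"
      using s_pos[OF b] assms(11) by (simp only: mult_le_cancel_left_pos mult_pos_pos)
    then have E: "s b * ?E \<le> 4 * (\<eta> \<bullet> b)\<^sup>2 / \<gamma> + 4 * real n * \<tau>\<^sup>2"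
      using assms(11) by (simp add: field_simps)
    have "s b / 2 * expectation (\<lambda>w. ((average (\<theta> w) n - \<theta>_star) \<bullet> b)\<^sup>2) = s b * ?E / (2 * ?N\<^sup>2)"
      unfolding avg by simp
    also have "\<dots> \<le> (4 * (\<eta> \<bullet> b)\<^sup>2 / \<gamma> + 4 * real n * \<tau>\<^sup>2) / (2 * ?N\<^sup>2)"
      using E by (intro divide_right_mono) simp_all
    also have "\<dots> = 2 * (\<eta> \<bullet> b)\<^sup>2 / (\<gamma> * ?N\<^sup>2) + 2 * real n * \<tau>\<^sup>2 / ?N\<^sup>2"
      by (simp add: add_divide_distrib)
    finally show "s b / 2 * expectation (\<lambda>w. ((average (\<theta> w) n - \<theta>_star) \<bullet> b)\<^sup>2)
      \<le> 2 * (\<eta> \<bullet> b)\<^sup>2 / (\<gamma> * ?N\<^sup>2) + 2 * real n * \<tau>\<^sup>2 / ?N\<^sup>2" .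
  qed

  \<comment> \<open>Summation over the eigenbasis\<close>
  have parseval: "(\<Sum>b\<in>B. (\<eta> \<bullet> b)\<^sup>2) = (norm \<eta>)\<^sup>2"
  proof -
    have "(norm \<eta>)\<^sup>2 = (\<Sum>b\<in>B. (\<eta> \<bullet> b) *\<^sub>R b) \<bullet> \<eta>"
      using expansion[of \<eta>] by (simp add: power2_norm_eq_inner)
    also have "\<dots> = (\<Sum>b\<in>B. (\<eta> \<bullet> b)\<^sup>2)"
      unfolding inner_sum_left
      by (intro sum.cong refl) (simp add: power2_eq_square inner_commute[of \<eta>])
    finally show ?thesis by simp
  qed
  have f: "f q = f \<theta>_star + (\<Sum>b\<in>B. s b / 2 * ((q - \<theta>_star) \<bullet> b)\<^sup>2)" for q
    using excess[of q] by simp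
  have "(\<integral>w. f (average (\<theta> w) n) \<partial>M) - f \<theta>_star
      = (\<Sum>b\<in>B. s b / 2 * expectation (\<lambda>w. ((average (\<theta> w) n - \<theta>_star) \<bullet> b)\<^sup>2))"
    by (subst f) (simp add: coord(1) prob_space)
  also have "\<dots> \<le> (\<Sum>b\<in>B. 2 * (\<eta> \<bullet> b)\<^sup>2 / (\<gamma> * ?N\<^sup>2) + 2 * real n * \<tau>\<^sup>2 / ?N\<^sup>2)"
    by (intro sum_mono coord(2))
  also have "\<dots> = 2 * (norm \<eta>)\<^sup>2 / (\<gamma> * ?N\<^sup>2) + real DIM('a) * (2 * real n * \<tau>\<^sup>2 / ?N\<^sup>2)"
    by (simp add: sum.distrib parseval[symmetric] sum_distrib_left sum_divide_distrib B(2))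
  also have "\<dots> \<le> 36 * ((norm \<eta>)\<^sup>2 / (\<gamma> * ?N\<^sup>2)) + 8 * (\<tau>\<^sup>2 * real DIM('a) / ?N)"
  proof (rule add_mono)
    have "0 \<le> (norm \<eta>)\<^sup>2 / (\<gamma> * ?N\<^sup>2)" using assms(11) by simp
    then show "2 * (norm \<eta>)\<^sup>2 / (\<gamma> * ?N\<^sup>2) \<le> 36 * ((norm \<eta>)\<^sup>2 / (\<gamma> * ?N\<^sup>2))"
      by simp
    \<comment> \<open>Only \<open>n\<close> inputs enter while the average divides by
      \<open>n + 1\<close>, so squaring that divisor still leaves decay of order 1/(n+1).\<close>
    have "real n / ?N\<^sup>2 \<le> 1 / ?N"
      by (simp add: divide_simps power2_eq_square)
    then have "2 * (\<tau>\<^sup>2 * real DIM('a)) * (real n / ?N\<^sup>2) \<le> 8 * (\<tau>\<^sup>2 * real DIM('a)) * (1 / ?N)"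
      by (intro mult_mono) simp_all
    then show "real DIM('a) * (2 * real n * \<tau>\<^sup>2 / ?N\<^sup>2) \<le> 8 * (\<tau>\<^sup>2 * real DIM('a) / ?N)"
      by (simp add: ac_simps)
  qed
  finally show ?thesis by (simp add: \<eta>_def)
qed

end
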